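(* Let $R$ be a nonassociative ring and let $(S,x)$ be a left generalized nonassociative Ore extension (left GNOE) of $R$ that satisfies the left Euclidean division algorithm. If $R$ is right Noetherian, then $S$ is right Noetherian.
   Context: Conventions: $\mathbb{N}$ includes $0$; all rings are unital; a nonassociative ring is a ring that is not necessarily associative. A right module over a nonassociative ring $R$ is an abelian group $M$ with a biadditive map $M\times R\to M$ (no further axioms); a submodule is a subgroup closed under this multiplication; $\langle N\rangle_R$ denotes the smallest right $R$-submodule containing $N$. Left modules are analogous. A left $R$-module is free with basis $B$ if each element is uniquely a finite sum $\sum_{b\in B} r_b b$ with $r_b\in R$. A module is Noetherian if each of its submodules is finitely generated; $R$ is right Noetherian if it is Noetherian as a right module over itself. Left GNOE: a pair $(S,x)$ such that (LG1) $S$ is a nonassociative ring containing $R$ as a (unital) subring, and $x\in S$; (LG2) $x$ is power-associative, i.e. the subring of $S$ generated by $x$ is associative; (LG3) $S$ is a free left $R$-module with basis $\{1,x,x^2,\dots\}$; (LG4) $(Rx^m)(Rx^n)\subseteq R+Rx+\cdots+Rx^{m+n}$ for all $m,n\in\mathbb{N}$. Left degree: a nonzero $p\in S$ is uniquely $p=r_0+r_1x+\cdots+r_nx^n$ with $r_i\in R$, $r_n\ne 0$; put $\deg_l p=n$, $\operatorname{lc}_l(p)=r_n$; also $\deg_l 0=-\infty$, $\operatorname{lc}_l(0)=0$ (with $-\infty$ plus anything equal to $-\infty$). Left degree-additive elements: for $p_1,\dots,p_n\in S$ and $I=\langle p_1,\dots,p_n\rangle_S$ (the right ideal of $S$ generated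 by the $p_i$), an element $s\in I$ is left degree-additive (with respect to $p_1,\dots,p_n$) if it has a representation $s=\sum_i\sum_j(\cdots((p_is_{ij1})s_{ij2})\cdots)s_{ijm}$ with $s_{ijk}\in S$, $1\le i\le n$, $1\le j,k\le m$, such that $\deg_l s=\max_i\bigl(\deg_l p_i+\max_j\sum_k\deg_l s_{ijk}\bigr)$. Left Euclidean division algorithm: $(S,x)$ satisfies it if for all $p_1,\dots,p_n\in S$ and nonzero $q\in S$ with $\deg_l q\ge\max_i\deg_l p_i$ and $\operatorname{lc}_l(q)\in\langle\operatorname{lc}_l(p_1),\dots,\operatorname{lc}_l(p_n)\rangle_R$, there exists a left degree-additive element $s$ of $\langle p_1,\dots,p_n\rangle_S$ (with respect to $p_1,\dots,p_n$) such that $\deg_l(q-s)<\deg_l q$. *)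

theory Defs
  imports "HOL-Library.Extended_Real"
begin

(* Unital, not necessarily associative; 0 = 1 is allowed. The parent class power only adds the
   iterated left product x ^ Suc n = x * x ^ n. *)
class nonassoc_ring = ab_group_add + power +
  assumes nonassoc_distrib_left: "a * (b + c) = a * b + a * c"
    and nonassoc_distrib_right: "(a + b) * c = a * c + b * c"
    and nonassoc_mult_1_left: "1 * a = a"
    and nonassoc_mult_1_right: "a * 1 = a"

(* The extension S is the type 'a itself (UNIV); the base ring R is a subset of it. *)

definition unital_subring :: "'a::nonassoc_ring set \<Rightarrow> bool" where
  "unital_subring A \<longleftrightarrow> 1 \<in> A \<and> (\<forall>a\<in>A. \<forall>b\<in>A. a - b \<in> A \<and> a * b \<in> A)"

definition power_associative :: "'a::nonassoc_ring \<Rightarrow> bool" where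
  "power_associative x \<longleftrightarrow>
    (\<forall>a \<in> unital_subring hull {x}. \<forall>b \<in> unital_subring hull {x}. \<forall>c \<in> unital_subring hull {x}.
      (a * b) * c = a * (b * c))"

(* Right A-submodules of the right A-module 'a, for a subring A. *)
definition right_submodule :: "'a::nonassoc_ring set \<Rightarrow> 'a set \<Rightarrow> bool" where
  "right_submodule A N \<longleftrightarrow>
    0 \<in> N \<and> (\<forall>u\<in>N. \<forall>v\<in>N. u - v \<in> N) \<and> (\<forall>u\<in>N. \<forall>a\<in>A. u * a \<in> N)"

definition right_span :: "'a::nonassoc_ring set \<Rightarrow> 'a set \<Rightarrow> 'a set" where
  "right_span A X = right_submodule A hull X"

definition noetherian_right_module :: "'a::nonassoc_ring set \<Rightarrow> 'a set \<Rightarrow> bool" where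
  "noetherian_right_module A M \<longleftrightarrow>
    (\<forall>N. right_submodule A N \<and> N \<subseteq> M \<longrightarrow> (\<exists>X. finite X \<and> N = right_span A X))"

definition right_noetherian :: "'a::nonassoc_ring set \<Rightarrow> bool" where
  "right_noetherian A \<longleftrightarrow> noetherian_right_module A A"

definition left_expansion :: "'a::nonassoc_ring set \<Rightarrow> ('i \<Rightarrow> 'a) \<Rightarrow> 'a \<Rightarrow> ('i \<Rightarrow> 'a) \<Rightarrow> bool" where
  "left_expansion R b p r \<longleftrightarrow>
    (\<forall>i. r i \<in> R) \<and> finite {i. r i \<noteq> 0} \<and> p = (\<Sum>i | r i \<noteq> 0. r i * b i)"

definition free_left_basis :: "'a::nonassoc_ring set \<Rightarrow> ('i \<Rightarrow> 'a) \<Rightarrow> bool" where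
  "free_left_basis R b \<longleftrightarrow> (\<forall>p. \<exists>!r. left_expansion R b p r)"

definition left_gnoe :: "'a::nonassoc_ring set \<Rightarrow> 'a \<Rightarrow> bool" where
  "left_gnoe R x \<longleftrightarrow>
    unital_subring R \<and>
    power_associative x \<and>
    free_left_basis R (\<lambda>n::nat. x ^ n) \<and>
    (\<forall>m n. \<forall>a\<in>R. \<forall>b\<in>R.
      (a * x ^ m) * (b * x ^ n) \<in> {\<Sum>k\<le>m + n. r k * x ^ k | r. \<forall>k. r k \<in> R})"

definition left_coeff :: "'a::nonassoc_ring set \<Rightarrow> 'a \<Rightarrow> 'a \<Rightarrow> nat \<Rightarrow> 'a" where
  "left_coeff R x p = (THE r. left_expansion R (\<lambda>n. x ^ n) p r)"

definition left_deg :: "'a::nonassoc_ring set \<Rightarrow> 'a \<Rightarrow> 'a \<Rightarrow> ereal" where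
  "left_deg R x p = (if p = 0 then -\<infinity> else ereal (real (Max {n. left_coeff R x p n \<noteq> 0})))"

definition left_lc :: "'a::nonassoc_ring set \<Rightarrow> 'a \<Rightarrow> 'a \<Rightarrow> 'a" where
  "left_lc R x p = (if p = 0 then 0 else left_coeff R x p (Max {n. left_coeff R x p n \<noteq> 0}))"

(* The generators are p 1, ..., p n; the foldl is the left-nested product
   (...((p i * t i j 1) * t i j 2) ...) * t i j m. *)
definition left_degree_additive ::
  "'a::nonassoc_ring set \<Rightarrow> 'a \<Rightarrow> nat \<Rightarrow> (nat \<Rightarrow> 'a) \<Rightarrow> 'a \<Rightarrow> bool" where
  "left_degree_additive R x n p s \<longleftrightarrow>
    s \<in> right_span UNIV (p ` {1..n}) \<and>
    (\<exists>m\<ge>1. \<exists>t.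
      s = (\<Sum>i=1..n. \<Sum>j=1..m. foldl (*) (p i) (map (t i j) [1..<Suc m])) \<and>
      left_deg R x s =
        (MAX i\<in>{1..n}. left_deg R x (p i) + (MAX j\<in>{1..m}. \<Sum>k=1..m. left_deg R x (t i j k))))"

definition left_euclidean_division :: "'a::nonassoc_ring set \<Rightarrow> 'a \<Rightarrow> bool" where
  "left_euclidean_division R x \<longleftrightarrow>
    (\<forall>n\<ge>1. \<forall>p q. q \<noteq> 0 \<and> left_deg R x q \<ge> (MAX i\<in>{1..n}. left_deg R x (p i)) \<and>
      left_lc R x q \<in> right_span R ((\<lambda>i. left_lc R x (p i)) ` {1..n}) \<longrightarrow>
      (\<exists>s. left_degree_additive R x n p s \<and> left_deg R x (q - s) < left_deg R x q))"

end

theory Submission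
  imports Defs
begin

text \<open>
  This is Hilbert's basis argument, run without ideals of leading coefficients of a given degree.
  Suppose that a right ideal \<open>N\<close> of \<open>S\<close> is not finitely generated.  Choose
  \<open>p 1, p 2, \<dots>\<close> in \<open>N\<close> greedily: \<open>p k\<close> has least possible degree among the elements of \<open>N\<close>
  outside the right ideal generated by its predecessors (\<open>greedy_sequence\<close>).  The degrees are
  then nondecreasing.  As \<open>R\<close> is right Noetherian, some leading coefficient
  \<open>lc (p (n + 1))\<close> lies in the right \<open>R\<close>-submodule generated by \<open>lc (p 1), \<dots>, lc (p n)\<close>
  (\<open>noetherian_sequence\<close>).  Euclidean division of \<open>q = p (n + 1)\<close> by \<open>p 1, \<dots>, p n\<close> now gives
  an \<open>s\<close> in the right ideal generated by \<open>p 1, \<dots>, p n\<close> with \<open>q - s\<close> of smaller degree than \<open>q\<close>.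
  But \<open>q - s\<close> is again in \<open>N\<close> and outside that ideal, which contradicts the minimal
  choice of \<open>q\<close>.

  Nonassociativity causes no difficulty, because the argument never multiplies two elements of
  \<open>S\<close> itself: division supplies the element \<open>s\<close>, and the rest uses the closure of submodules
  under subtraction and the well-ordering of the degrees.
\<close>

lemma right_submodule_right_span: "right_submodule A (right_span A X)"
  unfolding right_span_def by (rule hull_in) (auto simp: right_submodule_def)

lemma subset_right_span: "X \<subseteq> right_span A X"
  unfolding right_span_def by (rule hull_subset)

lemma right_span_minimal: "X \<subseteq> N \<Longrightarrow> right_submodule A N \<Longrightarrow> right_span A X \<subseteq> N"
  unfolding right_span_def by (rule hull_minimal)

lemma right_span_mono: "X \<subseteq> Y \<Longrightarrow> right_span A X \<subseteq> right_span A Y"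
  unfolding right_span_def by (rule hull_mono)

lemma right_submodule_diff: "right_submodule A N \<Longrightarrow> u \<in> N \<Longrightarrow> v \<in> N \<Longrightarrow> u - v \<in> N"
  by (simp add: right_submodule_def)

lemma right_submodule_zero: "right_submodule A N \<Longrightarrow> 0 \<in> N"
  by (simp add: right_submodule_def)

lemma right_submodule_diff_mem_iff:
  assumes "right_submodule A N" and "s \<in> N"
  shows "q - s \<in> N \<longleftrightarrow> q \<in> N"
proof
  have "0 - s \<in> N"
    using assms by (blast intro: right_submodule_diff right_submodule_zero)
  moreover assume "q - s \<in> N"
  ultimately have "(q - s) - (0 - s) \<in> N"
    using assms(1) by (blast intro: right_submodule_diff)
  then show "q \<in> N" by simp
qed (use assms in \<open>blast intro: right_submodule_diff\<close>)

lemma unital_subring_zero: "unital_subring A \<Longrightarrow> 0 \<in> A"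
  unfolding unital_subring_def by (metis diff_self)

lemma unital_subring_imp_right_submodule: "unital_subring A \<Longrightarrow> right_submodule A A"
  using unital_subring_zero by (auto simp: unital_subring_def right_submodule_def)

lemma right_submodule_incseq_UN:
  fixes N :: "nat \<Rightarrow> 'a::nonassoc_ring set"
  assumes sub: "\<And>k. right_submodule A (N k)" and "incseq N"
  shows "right_submodule A (\<Union>k. N k)"
proof -
  show ?thesis
    unfolding right_submodule_def
  proof (intro conjI ballI)
    show "0 \<in> (\<Union>k. N k)"
      using right_submodule_zero[OF sub[of 0]] by (rule UN_I[OF UNIV_I])
  next
    fix u v assume "u \<in> (\<Union>k. N k)" and "v \<in> (\<Union>k. N k)"
    then obtain i j where "u \<in> N i" and "v \<in> N j" by (elim UN_E)
    then have "u \<in> N (max i j)" and "v \<in> N (max i j)"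
      using incseqD[OF \<open>incseq N\<close>, of i "max i j"] incseqD[OF \<open>incseq N\<close>, of j "max i j"]
      by auto
    then have "u - v \<in> N (max i j)"
      by (rule right_submodule_diff[OF sub])
    then show "u - v \<in> (\<Union>k. N k)"
      by (rule UN_I[OF UNIV_I])
  next
    fix u a assume "u \<in> (\<Union>k. N k)" and "a \<in> A"
    then obtain i where "u \<in> N i" by (elim UN_E)
    then have "u * a \<in> N i"
      using sub[of i] \<open>a \<in> A\<close> unfolding right_submodule_def by simp
    then show "u * a \<in> (\<Union>k. N k)"
      by (rule UN_I[OF UNIV_I])
  qed
qed

text \<open>
  The ascending chain condition for the spans of initial segments: their union is a
  submodule, hence finitely generated, and its finitely many generators already occur in one
  initial segment.  The index can be taken positive because the chain stays constant from
  there on, and Euclidean division is by nonempty families.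
\<close>

lemma noetherian_sequence:
  fixes a :: "nat \<Rightarrow> 'a::nonassoc_ring"
  assumes noeth: "noetherian_right_module A M" and M: "right_submodule A M"
    and a: "\<And>k. a k \<in> M"
  obtains n where "n \<ge> 1" and "a (Suc n) \<in> right_span A (a ` {1..n})"
proof -
  define N where "N k = right_span A (a ` {1..k})" for k
  have inc: "incseq N"
    unfolding N_def incseq_def by (intro allI impI right_span_mono) auto
  have sub: "right_submodule A (N k)" for k
    unfolding N_def by (rule right_submodule_right_span)
  have "N k \<subseteq> M" for k
    unfolding N_def by (rule right_span_minimal) (use a M in auto)
  then have "right_submodule A (\<Union>k. N k) \<and> (\<Union>k. N k) \<subseteq> M"
    using right_submodule_incseq_UN[OF sub inc] by blast
  then have "\<exists>X. finite X \<and> (\<Union>k. N k) = right_span A X"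
    using noeth[unfolded noetherian_right_module_def, rule_format] by simp
  then obtain X where "finite X" and X: "(\<Union>k. N k) = right_span A X"
    by (elim exE conjE)
  have "X \<subseteq> (\<Union>k. N k)"
    unfolding X by (rule subset_right_span)
  with \<open>finite X\<close> have "\<exists>k. X \<subseteq> N k"
  proof (induction X rule: finite_induct)
    case (insert u X)
    then obtain i j where "u \<in> N i" and "X \<subseteq> N j" by auto
    then have "insert u X \<subseteq> N (max i j)"
      using incseqD[OF inc, of i "max i j"] incseqD[OF inc, of j "max i j"] by auto
    then show ?case by blast
  qed simp
  then obtain k where "X \<subseteq> N k" by blast
  then have "X \<subseteq> N (max 1 k)"
    using incseqD[OF inc, of k "max 1 k"] by auto
  then have "(\<Union>k. N k) \<subseteq> N (max 1 k)"
    unfolding X by (rule right_span_minimal[OF _ sub])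
  moreover have "a (Suc (max 1 k)) \<in> N (Suc (max 1 k))"
    unfolding N_def by (rule subsetD[OF subset_right_span]) auto
  ultimately have "a (Suc (max 1 k)) \<in> N (max 1 k)" by blast
  then show thesis
    using that[of "max 1 k"] unfolding N_def by simp
qed

text \<open>
  The terms already chosen generate a finitely generated submodule of \<open>N\<close>, so something of \<open>N\<close>
  is left over, and by well-ordering an element of least \<open>d\<close> can be taken from it.  Initial
  segments start at \<open>1\<close> to agree with the indexing of the generators in the division
  algorithm.
\<close>

lemma greedy_sequence:
  fixes N :: "'a::nonassoc_ring set" and d :: "'a \<Rightarrow> nat"
  assumes N: "right_submodule A N" and not_fg: "\<nexists>X. finite X \<and> N = right_span A X"
  obtains p :: "nat \<Rightarrow> 'a"
    where "\<And>k. p k \<in> N - right_span A (p ` {1..<k})"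
      and "\<And>k q. q \<in> N - right_span A (p ` {1..<k}) \<Longrightarrow> d (p k) \<le> d q"
proof -
  define P where "P p k q \<longleftrightarrow> q \<in> N - right_span A (p ` {1..<k}) \<and>
    (\<forall>q'. q' \<in> N - right_span A (p ` {1..<k}) \<longrightarrow> d q \<le> d q')"
    for p :: "nat \<Rightarrow> 'a" and k :: nat and q
  have "\<exists>p. \<forall>k. P p k (p k)"
  proof (rule dependent_wf_choice[OF wf_less_than])
    fix f g :: "nat \<Rightarrow> 'a" and k q
    assume "\<And>j. (j, k) \<in> less_than \<Longrightarrow> f j = g j"
    then have "f ` {1..<k} = g ` {1..<k}"
      by (intro image_cong) auto
    then show "P f k q = P g k q"
      unfolding P_def by simp
  next
    fix k and p :: "nat \<Rightarrow> 'a"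
    assume "\<And>j. (j, k) \<in> less_than \<Longrightarrow> P p j (p j)"
    then have "p ` {1..<k} \<subseteq> N"
      unfolding P_def by auto
    then have "right_span A (p ` {1..<k}) \<subseteq> N"
      using N by (rule right_span_minimal)
    moreover have "N \<noteq> right_span A (p ` {1..<k})"
      using not_fg finite_imageI[OF finite_atLeastLessThan, of p 1 k] by metis
    ultimately have "\<exists>q. q \<in> N - right_span A (p ` {1..<k})" by blast
    then obtain q where "q \<in> N - right_span A (p ` {1..<k})" by blast
    then show "\<exists>q. P p k q"
      using ex_has_least_nat[of "\<lambda>q. q \<in> N - right_span A (p ` {1..<k})" q d]
      unfolding P_def by blast
  qed
  then obtain p where "P p k (p k)" for k by blast
  then show thesis
    by (intro that[of p]) (simp_all add: P_def)
qed

lemma left_lc_mem: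
  assumes "left_gnoe R x"
  shows "left_lc R x p \<in> R"
proof -
  have "\<exists>!r. left_expansion R (\<lambda>n. x ^ n) p r"
    using assms unfolding left_gnoe_def free_left_basis_def by blast
  then have "left_expansion R (\<lambda>n. x ^ n) p (left_coeff R x p)"
    unfolding left_coeff_def by (rule theI')
  then have "left_coeff R x p n \<in> R" for n
    unfolding left_expansion_def by blast
  moreover have "0 \<in> R"
    using assms unital_subring_zero unfolding left_gnoe_def by blast
  ultimately show ?thesis
    unfolding left_lc_def by simp
qed

theorem theorem1:
  fixes R :: "'a::nonassoc_ring set" and x :: 'a
  assumes "left_gnoe R x"
    and "left_euclidean_division R x"
    and "right_noetherian R"
  shows "right_noetherian (UNIV :: 'a set)"
proof (rule ccontr)
  assume "\<not> right_noetherian (UNIV :: 'a set)"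
  then obtain N :: "'a set" where N: "right_submodule UNIV N"
    and not_fg: "\<nexists>X. finite X \<and> N = right_span UNIV X"
    unfolding right_noetherian_def noetherian_right_module_def by blast

  \<comment> \<open>The degree with values in \<open>nat\<close>, where minimal elements exist; it is the left degree
    only for nonzero elements, but every element outside a submodule is nonzero.\<close>
  define d where "d p = Max {n. left_coeff R x p n \<noteq> 0}" for p
  have deg: "left_deg R x p = ereal (real (d p))" if "p \<noteq> 0" for p
    using that unfolding left_deg_def d_def by simp

  obtain p :: "nat \<Rightarrow> 'a" where p: "\<And>k. p k \<in> N - right_span UNIV (p ` {1..<k})"
    and least: "\<And>k q. q \<in> N - right_span UNIV (p ` {1..<k}) \<Longrightarrow> d (p k) \<le> d q"
    by (rule greedy_sequence[OF N not_fg, where d = d]) blast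
  have p_nz: "p k \<noteq> 0" for k
    using p[of k] right_submodule_zero[OF right_submodule_right_span] by (metis DiffD2)
  \<comment> \<open>The term \<open>p k\<close> was already a candidate when \<open>p i\<close> was chosen.\<close>
  have mono: "d (p i) \<le> d (p k)" if "i \<le> k" for i k
  proof (rule least)
    have "right_span UNIV (p ` {1..<i}) \<subseteq> right_span UNIV (p ` {1..<k})"
      using that by (intro right_span_mono image_mono) auto
    then show "p k \<in> N - right_span UNIV (p ` {1..<i})"
      using p[of k] by blast
  qed

  have "right_submodule R R"
    using assms(1) unital_subring_imp_right_submodule unfolding left_gnoe_def by blast
  then obtain n where "n \<ge> 1"
    and lc: "left_lc R x (p (Suc n)) \<in> right_span R ((\<lambda>i. left_lc R x (p i)) ` {1..n})"
    by (rule noetherian_sequence[OF assms(3)[unfolded right_noetherian_def],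
          where a = "\<lambda>i. left_lc R x (p i)"])
      (rule left_lc_mem[OF assms(1)])

  define q where "q = p (Suc n)"
  define I where "I = right_span UNIV (p ` {1..n})"
  have I: "right_submodule UNIV I"
    unfolding I_def by (rule right_submodule_right_span)
  have "{1..<Suc n} = {1..n}" by auto
  then have q: "q \<in> N" "q \<notin> I" and q_least: "\<And>q'. q' \<in> N \<Longrightarrow> q' \<notin> I \<Longrightarrow> d q \<le> d q'"
    using p[of "Suc n"] least[of _ "Suc n"] unfolding q_def I_def by auto
  have "I \<subseteq> N"
    unfolding I_def by (rule right_span_minimal) (use p N in auto)

  have "left_deg R x (p i) \<le> left_deg R x q" if "i \<le> n" for i
    using mono[of i "Suc n"] that unfolding q_def by (simp add: deg p_nz)
  then have "(MAX i\<in>{1..n}. left_deg R x (p i)) \<le> left_deg R x q"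
    using \<open>n \<ge> 1\<close> by (subst Max_le_iff) auto
  moreover have "q \<noteq> 0"
    unfolding q_def by (rule p_nz)
  ultimately have "\<exists>s. left_degree_additive R x n p s \<and> left_deg R x (q - s) < left_deg R x q"
    using lc unfolding q_def[symmetric]
    by (intro assms(2)[unfolded left_euclidean_division_def, rule_format] \<open>n \<ge> 1\<close>) simp
  then obtain s where s: "left_degree_additive R x n p s"
    and less: "left_deg R x (q - s) < left_deg R x q"
    by (elim exE conjE)
  from s have "s \<in> I"
    unfolding left_degree_additive_def I_def by (rule conjunct1)
  then have "q - s \<notin> I" and "q - s \<in> N"
    using q I N \<open>I \<subseteq> N\<close> by (auto simp: right_submodule_diff_mem_iff)
  moreover from \<open>q - s \<notin> I\<close> have "q - s \<noteq> 0"
    using right_submodule_zero[OF I] by auto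
  then have "d (q - s) < d q"
    using less \<open>q \<noteq> 0\<close> by (simp add: deg)
  ultimately show False
    using q_least[of "q - s"] by simp
qed

end
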